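(* Let $M\in\mathbb{R}^{n\times n}$ be symmetric positive-definite, let $A\in\mathbb{R}^{m\times n}$ (possibly rank-deficient), let $P$ be the orthogonal projection of $\mathbb{R}^n$ onto the null space of $A$, and let $Q=I-P$. For a positive scalar $\mu$ let $\bar M(\mu)=PMP+\mu Q$ be the constraint inertia matrix. Then the optimal value of $\mu$ minimizing the condition number $\operatorname{cond}(\bar M(\mu))$ satisfies the inequalities $$\lambda_{\min\neq 0}(PMP)\le \mu\le\lambda_{\max}(PMP).$$
   Context: $M$ is the inertia matrix and $A$ the constraint matrix of a constrained mechanical system, evaluated at a given configuration. For a symmetric positive-definite matrix, $\operatorname{cond}$ is the ratio of the largest to the smallest eigenvalue. $\lambda_{\max}(PMP)$ denotes the largest eigenvalue of the symmetric matrix $PMP$, and $\lambda_{\min\neq0}(PMP)$ its smallest non-zero eigenvalue.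
   Formalization: The null space of A is assumed nonzero (otherwise PMP = 0 has no non-zero eigenvalue); for A = 0, where every μ > 0 is optimal, only existence of an optimal μ in the interval is claimed, while for A ≠ 0 every optimal μ satisfies the inequalities. *)

theory Defs
  imports "HOL-Analysis.Analysis"
begin

definition sym_pos_def :: "real^'n^'n \<Rightarrow> bool" where
  "sym_pos_def M \<longleftrightarrow> transpose M = M \<and> (\<forall>x. x \<noteq> 0 \<longrightarrow> x \<bullet> (M *v x) > 0)"

definition null_space :: "real^'n^'m \<Rightarrow> (real^'n) set" where
  "null_space A = {x. A *v x = 0}"

definition is_orthogonal_projection :: "real^'n^'n \<Rightarrow> (real^'n) set \<Rightarrow> bool" where
  "is_orthogonal_projection P S \<longleftrightarrow>
     (\<forall>x. P *v x \<in> S \<and> (\<forall>y\<in>S. orthogonal (x - P *v x) y))"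

definition eigenvalues :: "real^'n^'n \<Rightarrow> real set" where
  "eigenvalues B = {l. \<exists>v. v \<noteq> 0 \<and> B *v v = l *\<^sub>R v}"

text \<open>
  \<^const>\<open>Max\<close> and \<^const>\<open>Min\<close> are unspecified on the empty set. The set \<open>eigenvalues B\<close> is always
  finite, and it is nonempty for symmetric \<open>B\<close>; a nonzero eigenvalue exists for symmetric
  \<open>B \<noteq> 0\<close>.
\<close>

definition lambda_max :: "real^'n^'n \<Rightarrow> real" where
  "lambda_max B = Max (eigenvalues B)"

definition lambda_min :: "real^'n^'n \<Rightarrow> real" where
  "lambda_min B = Min (eigenvalues B)"

definition lambda_min_nonzero :: "real^'n^'n \<Rightarrow> real" where
  "lambda_min_nonzero B = Min (eigenvalues B - {0})"

definition cond :: "real^'n^'n \<Rightarrow> real" where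
  "cond B = lambda_max B / lambda_min B"

definition constraint_inertia :: "real^'n^'n \<Rightarrow> real^'n^'n \<Rightarrow> real \<Rightarrow> real^'n^'n" where
  "constraint_inertia M P \<mu> = P ** M ** P + \<mu> *\<^sub>R (mat 1 - P)"

definition optimal_scalar :: "real^'n^'n \<Rightarrow> real^'n^'n \<Rightarrow> real \<Rightarrow> bool" where
  "optimal_scalar M P \<mu> \<longleftrightarrow>
     is_arg_min (\<lambda>\<nu>. cond (constraint_inertia M P \<nu>)) (\<lambda>\<nu>. \<nu> > 0) \<mu>"

end

theory Submission
  imports Defs
begin

text \<open>
  The operator \<open>PMP\<close> vanishes on the orthogonal complement of the null space \<open>S\<close> of \<open>A\<close> and is
  positive definite on \<open>S\<close>, so the constraint inertia matrix has as eigenvalues the non-zero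
  eigenvalues of \<open>PMP\<close> together with \<open>\<mu>\<close> (unless \<open>A = 0\<close>, when the complement is trivial). With
  \<open>a\<close> and \<open>b\<close> the extreme non-zero eigenvalues of \<open>PMP\<close>, its condition number is therefore
  \<open>max b \<mu> / min a \<mu>\<close>, which is at least \<open>b / a\<close> with equality exactly for \<open>a \<le> \<mu> \<le> b\<close>.
\<close>

section \<open>Symmetric matrices: extremal eigenvalue and finiteness of the spectrum\<close>

lemma transpose_eq_self_iff:
  fixes B :: "real^'n^'n"
  shows "transpose B = B \<longleftrightarrow> (\<forall>x y. (B *v x) \<bullet> y = x \<bullet> (B *v y))"
proof
  assume "transpose B = B"
  then show "\<forall>x y. (B *v x) \<bullet> y = x \<bullet> (B *v y)"
    by (metis dot_lmul_matrix transpose_matrix_vector)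
next
  assume "\<forall>x y. (B *v x) \<bullet> y = x \<bullet> (B *v y)"
  then have "(transpose B *v x) \<bullet> y = (B *v x) \<bullet> y" for x y
    by (simp add: dot_lmul_matrix)
  then show "transpose B = B"
    by (metis matrix_eq vector_eq_rdot)
qed

text \<open>If \<open>D *v v\<close> were some \<open>w\<close> other than 0, a small step from
  \<open>v\<close> along \<open>-w\<close> would make the quadratic form negative: the linear term
  \<open>-2 * t * (w \<bullet> w)\<close> dominates the quadratic term
  \<open>t\<^sup>2 * c\<close>.\<close>

lemma psd_kernel:
  fixes D :: "real^'n^'n"
  assumes sym: "transpose D = D" and psd: "\<And>x. x \<bullet> (D *v x) \<ge> 0"
    and v: "v \<bullet> (D *v v) = 0"
  shows "D *v v = 0"
proof (rule ccontr)
  assume nz: "D *v v \<noteq> 0"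
  define w where "w = D *v v"
  define c where "c = w \<bullet> (D *v w)"
  \<comment> \<open>Any positive \<open>t\<close> with \<open>t * c < 2 * (w \<bullet> w)\<close>
    would do; adding 1 keeps the denominator positive when \<open>c = 0\<close>.\<close>
  define t where "t = (w \<bullet> w) / (c + 1)"
  have c: "c \<ge> 0" and ww: "w \<bullet> w > 0"
    using psd nz by (auto simp: c_def w_def)
  have t: "t > 0" using c ww by (simp add: t_def)
  have "v \<bullet> (D *v w) = w \<bullet> w"
    using sym unfolding transpose_eq_self_iff w_def by metis
  then have "(v - t *\<^sub>R w) \<bullet> (D *v (v - t *\<^sub>R w)) = t * (t * c - 2 * (w \<bullet> w))"
    using v by (simp add: matrix_vector_mult_diff_distrib scaleR_matrix_vector_assoc[symmetric]
        matrix_vector_mult_scaleR inner_diff_left inner_diff_right c_def w_def[symmetric] algebra_simps)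
  then have "t * c - 2 * (w \<bullet> w) \<ge> 0"
    using psd[of "v - t *\<^sub>R w"] t by (simp add: zero_le_mult_iff)
  moreover have "t * c < 2 * (w \<bullet> w)"
    using c ww unfolding t_def by (simp add: field_simps add_nonneg_pos)
  ultimately show False by simp
qed

text \<open>The quadratic form attains its maximum \<open>l\<close> on the compact unit sphere, at
  some \<open>v\<close>. Then \<open>l *\<^sub>R mat 1 - B\<close> is positive semidefinite and its
  form vanishes at \<open>v\<close>, so \<open>psd_kernel\<close> makes \<open>v\<close> an
  eigenvector.\<close>

lemma symmetric_Rayleigh_eigenvalue:
  fixes B :: "real^'n^'n"
  assumes sym: "transpose B = B"
  obtains l where "l \<in> eigenvalues B" "\<And>x. x \<bullet> (B *v x) \<le> l * (x \<bullet> x)"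
proof -
  have "continuous_on (sphere 0 1) (\<lambda>x. x \<bullet> (B *v x))"
    by (intro continuous_intros linear_continuous_on) auto
  then have "\<exists>v\<in>sphere 0 1. \<forall>y\<in>sphere 0 1. y \<bullet> (B *v y) \<le> v \<bullet> (B *v v)"
    by (intro continuous_attains_sup) auto
  then obtain v where v: "norm v = 1"
    and max: "\<And>y. norm y = 1 \<Longrightarrow> y \<bullet> (B *v y) \<le> v \<bullet> (B *v v)"
    by auto
  define l where "l = v \<bullet> (B *v v)"
  have le: "x \<bullet> (B *v x) \<le> l * (x \<bullet> x)" for x
  proof (cases "x = 0")
    case False
    then have "(x \<bullet> (B *v x)) / (norm x)\<^sup>2 \<le> l"
      using max[of "x /\<^sub>R norm x"]
      by (simp add: l_def matrix_vector_mult_scaleR power2_eq_square field_simps)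
    then show ?thesis
      using False by (simp add: dot_square_norm field_simps)
  qed simp
  define D where "D = l *\<^sub>R mat 1 - B"
  have D: "D *v x = l *\<^sub>R x - B *v x" for x
    by (simp add: D_def matrix_vector_mult_diff_rdistrib scaleR_matrix_vector_assoc[symmetric])
  have "D *v v = 0"
  proof (rule psd_kernel)
    show "transpose D = D"
      using sym unfolding transpose_eq_self_iff by (simp add: D inner_diff_left inner_diff_right)
    show "x \<bullet> (D *v x) \<ge> 0" for x
      using le by (simp add: D inner_diff_right)
    show "v \<bullet> (D *v v) = 0"
      using v by (simp add: D inner_diff_right l_def dot_square_norm)
  qed
  then have "l \<in> eigenvalues B"
    using v unfolding eigenvalues_def D by (auto intro!: exI[of _ v])
  then show thesis using le that by blast
qed

text \<open>Eigenvectors for distinct eigenvalues are orthogonal, and an orthogonal family in a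
  finite-dimensional space is finite. This is what gives \<open>Max\<close> and \<open>Min\<close>
  their meaning below.\<close>

lemma finite_eigenvalues_symmetric:
  fixes B :: "real^'n^'n"
  assumes sym: "transpose B = B"
  shows "finite (eigenvalues B)"
proof -
  have "\<forall>l\<in>eigenvalues B. \<exists>v. v \<noteq> 0 \<and> B *v v = l *\<^sub>R v"
    by (simp add: eigenvalues_def)
  then obtain v where v: "\<And>l. l \<in> eigenvalues B \<Longrightarrow> v l \<noteq> 0 \<and> B *v v l = l *\<^sub>R v l"
    by (auto simp: bchoice_iff)
  have orth: "v l \<bullet> v k = 0" if "l \<in> eigenvalues B" "k \<in> eigenvalues B" "l \<noteq> k" for l k
  proof -
    have "l * (v l \<bullet> v k) = (B *v v l) \<bullet> v k" using v that by simp
    also have "\<dots> = v l \<bullet> (B *v v k)"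
      using sym unfolding transpose_eq_self_iff by blast
    also have "\<dots> = k * (v l \<bullet> v k)" using v that by simp
    finally show ?thesis using that by simp
  qed
  have "pairwise orthogonal (v ` eigenvalues B)"
    using orth unfolding pairwise_def orthogonal_def by blast
  then have "finite (v ` eigenvalues B)" by (rule pairwise_orthogonal_imp_finite)
  moreover have "inj_on v (eigenvalues B)"
    using orth v by (metis inj_onI inner_eq_zero_iff)
  ultimately show ?thesis using finite_imageD by blast
qed

section \<open>The null space and the orthogonal projection onto it\<close>

lemma subspace_null_space: "subspace (null_space A)"
  unfolding null_space_def
  by (auto simp: subspace_def matrix_vector_right_distrib matrix_vector_mult_scaleR)

lemma null_space_eq_UNIV_iff: "null_space A = UNIV \<longleftrightarrow> A = 0"
  unfolding null_space_def by (auto simp: matrix_eq)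

context
  fixes P :: "real^'n^'n" and S :: "(real^'n) set"
  assumes proj: "is_orthogonal_projection P S" and S: "subspace S"
begin

lemma projection_in: "P *v x \<in> S"
  using proj by (simp add: is_orthogonal_projection_def)

text \<open>For \<open>x\<close> in \<open>S\<close> the residual \<open>x - P *v x\<close> lies in
  \<open>S\<close> and is orthogonal to \<open>S\<close>, hence to itself.\<close>

lemma projection_fixes:
  assumes "x \<in> S"
  shows "P *v x = x"
proof -
  have "x - P *v x \<in> S"
    using assms S projection_in by (simp add: subspace_diff)
  then have "orthogonal (x - P *v x) (x - P *v x)"
    using proj by (simp add: is_orthogonal_projection_def)
  then show ?thesis by (simp add: orthogonal_def)
qed

lemma projection_self_adjoint: "(P *v x) \<bullet> y = x \<bullet> (P *v y)"
proof -
  have "(x - P *v x) \<bullet> (P *v y) = 0" "(y - P *v y) \<bullet> (P *v x) = 0"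
    using proj projection_in by (simp_all add: is_orthogonal_projection_def orthogonal_def)
  then show ?thesis by (simp add: inner_diff_left inner_diff_right inner_commute)
qed

section \<open>Spectrum of the compression \<open>P ** M ** P\<close>\<close>

context
  fixes M :: "real^'n^'n"
  assumes M: "sym_pos_def M"
begin

lemma compression_vec: "(P ** M ** P) *v x = P *v (M *v (P *v x))"
  by (simp add: matrix_vector_mul_assoc[symmetric])

lemma compression_inner: "x \<bullet> ((P ** M ** P) *v y) = (P *v x) \<bullet> (M *v (P *v y))"
  by (simp add: compression_vec projection_self_adjoint)

lemma transpose_compression: "transpose (P ** M ** P) = P ** M ** P"
proof -
  have "(M *v x) \<bullet> y = x \<bullet> (M *v y)" for x y
    using M by (simp add: sym_pos_def_def transpose_eq_self_iff)
  then show ?thesis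
    unfolding transpose_eq_self_iff by (simp add: compression_vec projection_self_adjoint)
qed

text \<open>On \<open>S\<close> the quadratic forms of the compression and of \<open>M\<close>
  coincide.\<close>

lemma eigenvalue_compression_on_subspace:
  assumes "v \<in> S" "v \<noteq> 0" "(P ** M ** P) *v v = l *\<^sub>R v"
  shows "l > 0"
proof -
  have "l * (v \<bullet> v) = v \<bullet> (M *v v)"
    using compression_inner[of v v] assms by (simp add: projection_fixes)
  moreover have "v \<bullet> (M *v v) > 0" using M assms by (simp add: sym_pos_def_def)
  moreover have "v \<bullet> v > 0" using assms by simp
  ultimately show ?thesis by (metis zero_less_mult_pos2)
qed

text \<open>Dividing the eigenvalue equation by \<open>l\<close> exhibits \<open>v\<close> as a
  value of \<open>P\<close>.\<close>

lemma nonzero_eigenvector_compression: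
  assumes "l \<in> eigenvalues (P ** M ** P) - {0}"
  obtains v where "v \<in> S" "v \<noteq> 0" "(P ** M ** P) *v v = l *\<^sub>R v"
proof -
  obtain v where v: "v \<noteq> 0" "(P ** M ** P) *v v = l *\<^sub>R v" and "l \<noteq> 0"
    using assms by (auto simp: eigenvalues_def)
  then have "v = (1 / l) *\<^sub>R (P *v (M *v (P *v v)))"
    by (simp add: compression_vec)
  also have "\<dots> \<in> S"
    using S projection_in by (intro subspace_scale)
  finally have "v \<in> S" .
  then show thesis using v that by blast
qed

lemma nonzero_eigenvalue_compression_pos:
  assumes "l \<in> eigenvalues (P ** M ** P) - {0}"
  shows "l > 0"
  using assms nonzero_eigenvector_compression eigenvalue_compression_on_subspace by metis

text \<open>The top eigenvalue bounds the form at a non-zero vector of \<open>S\<close>, where the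
  form is positive, so it cannot be 0.\<close>

lemma nonzero_eigenvalues_compression_nonempty:
  assumes "S \<noteq> {0}"
  shows "eigenvalues (P ** M ** P) - {0} \<noteq> {}"
proof -
  obtain s where s: "s \<in> S" "s \<noteq> 0"
    using assms S by (auto simp: subspace_def)
  obtain l where l: "l \<in> eigenvalues (P ** M ** P)"
    and le: "\<And>x. x \<bullet> ((P ** M ** P) *v x) \<le> l * (x \<bullet> x)"
    using symmetric_Rayleigh_eigenvalue[OF transpose_compression] by blast
  have "0 < s \<bullet> (M *v s)" using M s by (simp add: sym_pos_def_def)
  also have "\<dots> \<le> l * (s \<bullet> s)"
    using le[of s] s by (simp add: compression_inner projection_fixes)
  finally have "l \<noteq> 0" by auto
  then show ?thesis using l by blast
qed

section \<open>Spectrum and condition number of the constraint inertia matrix\<close>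

lemma constraint_inertia_vec:
  "constraint_inertia M P \<mu> *v x = (P ** M ** P) *v x + \<mu> *\<^sub>R (x - P *v x)"
  by (simp add: constraint_inertia_def matrix_vector_mult_add_rdistrib
      matrix_vector_mult_diff_rdistrib scaleR_matrix_vector_assoc[symmetric])

text \<open>The matrix acts as the compression on \<open>S\<close> and as the scalar
  \<open>\<mu>\<close> on the orthogonal complement; the latter contributes an eigenvalue only if it
  is nontrivial.\<close>

lemma eigenvalues_constraint_inertia:
  "eigenvalues (constraint_inertia M P \<mu>) =
     (eigenvalues (P ** M ** P) - {0}) \<union> (if S = UNIV then {} else {\<mu>})"
proof (intro equalityI subsetI)
  fix l assume "l \<in> eigenvalues (constraint_inertia M P \<mu>)"
  then obtain v where v: "v \<noteq> 0"
    and eq: "(P ** M ** P) *v v + \<mu> *\<^sub>R (v - P *v v) = l *\<^sub>R v"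
    by (auto simp: eigenvalues_def constraint_inertia_vec)
  show "l \<in> (eigenvalues (P ** M ** P) - {0}) \<union> (if S = UNIV then {} else {\<mu>})"
  proof (cases "P *v v = 0")
    case True
    then have "v \<notin> S" using v projection_fixes by auto
    moreover have "l = \<mu>" using eq v True by (simp add: compression_vec)
    ultimately show ?thesis by auto
  next
    case False
    \<comment> \<open>Applying \<open>P\<close> removes the \<open>\<mu>\<close> term, so the
      component \<open>P *v v\<close> is an eigenvector of the compression for the same
      \<open>l\<close>.\<close>
    have "P *v ((P ** M ** P) *v v + \<mu> *\<^sub>R (v - P *v v)) = l *\<^sub>R (P *v v)"
      by (simp add: eq matrix_vector_mult_scaleR)
    then have "(P ** M ** P) *v (P *v v) = l *\<^sub>R (P *v v)"
      by (simp add: compression_vec matrix_vector_right_distrib matrix_vector_mult_scaleR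
          matrix_vector_mult_diff_distrib projection_fixes projection_in)
    moreover from this have "l > 0"
      using False projection_in eigenvalue_compression_on_subspace by blast
    ultimately show ?thesis using False by (auto simp: eigenvalues_def)
  qed
next
  fix l assume l: "l \<in> (eigenvalues (P ** M ** P) - {0}) \<union> (if S = UNIV then {} else {\<mu>})"
  show "l \<in> eigenvalues (constraint_inertia M P \<mu>)"
  proof (cases "l \<in> eigenvalues (P ** M ** P) - {0}")
    case True
    then obtain v where "v \<in> S" "v \<noteq> 0" "(P ** M ** P) *v v = l *\<^sub>R v"
      by (rule nonzero_eigenvector_compression)
    then show ?thesis
      by (auto simp: eigenvalues_def constraint_inertia_vec projection_fixes intro!: exI[of _ v])
  next
    case False
    then obtain x where "l = \<mu>" "x \<notin> S" using l by (auto split: if_splits)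
    \<comment> \<open>The residual of a vector outside \<open>S\<close> is non-zero and killed by
      \<open>P\<close>: it serves as eigenvector for \<open>\<mu>\<close>.\<close>
    moreover have "P *v (x - P *v x) = 0"
      by (simp add: matrix_vector_mult_diff_distrib projection_fixes projection_in)
    moreover have "x - P *v x \<noteq> 0"
      using \<open>x \<notin> S\<close> projection_in by (metis eq_iff_diff_eq_0)
    ultimately show ?thesis
      unfolding eigenvalues_def mem_Collect_eq constraint_inertia_vec
      by (intro exI[of _ "x - P *v x"]) (simp add: compression_vec)
  qed
qed

text \<open>The non-zero eigenvalues are positive, so discarding a possible eigenvalue 0 does not
  change the maximum.\<close>

lemma lambda_max_compression:
  assumes "S \<noteq> {0}"
  shows "lambda_max (P ** M ** P) = Max (eigenvalues (P ** M ** P) - {0})"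
proof -
  let ?E = "eigenvalues (P ** M ** P)"
  have fin: "finite ?E" by (rule finite_eigenvalues_symmetric[OF transpose_compression])
  have ne: "?E - {0} \<noteq> {}" using assms by (rule nonzero_eigenvalues_compression_nonempty)
  have "Max (?E - {0}) \<in> ?E - {0}" using fin ne by (intro Max_in) auto
  moreover from this have "Max (?E - {0}) > 0" by (rule nonzero_eigenvalue_compression_pos)
  moreover have "x \<le> Max (?E - {0})" if "x \<in> ?E" for x
  proof (cases "x = 0")
    case True
    then show ?thesis using \<open>Max (?E - {0}) > 0\<close> by simp
  next
    case False
    then show ?thesis using fin that by (intro Max_ge) auto
  qed
  ultimately show ?thesis
    unfolding lambda_max_def using fin by (intro Max_eqI) blast+
qed

lemma cond_constraint_inertia:
  assumes "S \<noteq> {0}"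
  shows "cond (constraint_inertia M P \<mu>) =
    (if S = UNIV then lambda_max (P ** M ** P) / lambda_min_nonzero (P ** M ** P)
     else max (lambda_max (P ** M ** P)) \<mu> / min (lambda_min_nonzero (P ** M ** P)) \<mu>)"
proof -
  let ?E = "eigenvalues (P ** M ** P) - {0}"
  have "finite ?E"
    using finite_eigenvalues_symmetric[OF transpose_compression] by simp
  moreover have "?E \<noteq> {}" using assms by (rule nonzero_eigenvalues_compression_nonempty)
  ultimately show ?thesis
    by (simp add: cond_def lambda_max_compression[OF assms] lambda_min_nonzero_def
        lambda_min_def lambda_max_def[of "constraint_inertia M P \<mu>"]
        eigenvalues_constraint_inertia max.commute min.commute)
qed

lemma lambda_min_nonzero_compression_bounds:
  assumes "S \<noteq> {0}"
  shows "0 < lambda_min_nonzero (P ** M ** P)"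
    and "lambda_min_nonzero (P ** M ** P) \<le> lambda_max (P ** M ** P)"
proof -
  let ?E = "eigenvalues (P ** M ** P) - {0}"
  have fin: "finite ?E"
    using finite_eigenvalues_symmetric[OF transpose_compression] by simp
  have "?E \<noteq> {}" using assms by (rule nonzero_eigenvalues_compression_nonempty)
  with fin have min: "Min ?E \<in> ?E" by (rule Min_in)
  then show "0 < lambda_min_nonzero (P ** M ** P)"
    unfolding lambda_min_nonzero_def by (rule nonzero_eigenvalue_compression_pos)
  show "lambda_min_nonzero (P ** M ** P) \<le> lambda_max (P ** M ** P)"
    unfolding lambda_min_nonzero_def lambda_max_compression[OF assms]
    using fin min by (rule Max_ge)
qed

end

end

section \<open>Minimization over the scalar\<close>

lemma max_div_min_ge:
  fixes a b \<mu> :: real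
  assumes "0 < a" "a \<le> b" "0 < \<mu>"
  shows "b / a \<le> max b \<mu> / min a \<mu>"
  using assms by (intro frac_le) auto

text \<open>Outside the interval the ratio is strictly larger: \<open>\<mu> < a\<close> shrinks the
  denominator, \<open>\<mu> > b\<close> raises the numerator.\<close>

lemma max_div_min_le_iff:
  fixes a b \<mu> :: real
  assumes "0 < a" "a \<le> b" "0 < \<mu>"
  shows "max b \<mu> / min a \<mu> \<le> b / a \<longleftrightarrow> a \<le> \<mu> \<and> \<mu> \<le> b"
proof
  assume le: "max b \<mu> / min a \<mu> \<le> b / a"
  have "b / a < max b \<mu> / min a \<mu>" if "\<mu> < a"
    using that assms by (intro frac_less2) auto
  moreover have "b / a < max b \<mu> / min a \<mu>" if "b < \<mu>"
    using that assms by (intro frac_less) auto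
  ultimately show "a \<le> \<mu> \<and> \<mu> \<le> b" using le by force
qed (use assms in auto)

text \<open>A nontrivial null space ensures that the compression has a non-zero eigenvalue. If
  \<open>A = 0\<close>, then \<open>P\<close> is the identity and the condition number does not
  depend on \<open>\<mu>\<close>: every positive scalar is optimal, and only the existence of an
  optimal one within the bounds can be claimed.\<close>

theorem proposition1:
  fixes M P :: "real^'n^'n" and A :: "real^'n^'m"
  assumes "sym_pos_def M"
    and "is_orthogonal_projection P (null_space A)"
    and "null_space A \<noteq> {0}"
  shows "(\<exists>\<mu>. optimal_scalar M P \<mu> \<and>
            lambda_min_nonzero (P ** M ** P) \<le> \<mu> \<and> \<mu> \<le> lambda_max (P ** M ** P)) \<and>
         (A \<noteq> 0 \<longrightarrow>
          (\<forall>\<mu>. optimal_scalar M P \<mu> \<longrightarrow>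
            lambda_min_nonzero (P ** M ** P) \<le> \<mu> \<and> \<mu> \<le> lambda_max (P ** M ** P)))"
proof -
  let ?a = "lambda_min_nonzero (P ** M ** P)" and ?b = "lambda_max (P ** M ** P)"
  note hyps = assms(2) subspace_null_space assms(1,3)
  note ab = lambda_min_nonzero_compression_bounds[OF hyps]
  have cond: "cond (constraint_inertia M P \<mu>) =
      (if A = 0 then ?b / ?a else max ?b \<mu> / min ?a \<mu>)" for \<mu>
    using cond_constraint_inertia[OF hyps] by (simp only: null_space_eq_UNIV_iff)
  \<comment> \<open>The left end of the interval is positive and attains the lower bound
    \<open>?b / ?a\<close>.\<close>
  have "optimal_scalar M P ?a"
    using ab max_div_min_ge[OF ab]
    by (fastforce simp: optimal_scalar_def is_arg_min_def cond not_less max_absorb1)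
  moreover have "?a \<le> \<mu> \<and> \<mu> \<le> ?b" if "A \<noteq> 0" "optimal_scalar M P \<mu>" for \<mu>
  proof -
    have "\<mu> > 0" and opt: "\<not> cond (constraint_inertia M P \<nu>) < cond (constraint_inertia M P \<mu>)"
      if "\<nu> > 0" for \<nu>
      using \<open>optimal_scalar M P \<mu>\<close> that by (auto simp: optimal_scalar_def is_arg_min_def)
    \<comment> \<open>Comparison with \<open>?a\<close> bounds the ratio at \<open>\<mu>\<close> by
      \<open>?b / ?a\<close>, which is the equality case.\<close>
    then show ?thesis
      using opt[of ?a] max_div_min_le_iff[OF ab] ab \<open>A \<noteq> 0\<close>
      by (simp add: cond not_less max_absorb1)
  qed
  ultimately show ?thesis using ab by blast
qed

end
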